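(* Let $\mathbb{F}_q$ be a finite field, $k\ge 1$, $a\in\mathbb{F}_q[x_1,\dots,x_k]$, and let $\mathcal{A}=(P,Q)$ be either $(\{a\},\emptyset)$ or $(\emptyset,\{a\})$. Let $\boldsymbol{\alpha}\in\mathbb{F}_q^{k-1}$ be such that there is no $\beta\in\mathbb{F}_q$ with $(\boldsymbol{\alpha},\beta)\in\mathrm{zero}_q(P/Q)$. Write $a=c_1x_k^{d_1}+\dots+c_mx_k^{d_m}$ with pairwise distinct $d_i$ and $c_i\in\mathbb{F}_q[x_1,\dots,x_{k-1}]$, let $\gamma_i=c_i(\boldsymbol{\alpha})\in\mathbb{F}_q$, and let $\mathrm{Proj_{Coeff}}(\mathcal{A},\boldsymbol{\alpha})=\Delta=\{(\emptyset,\{c_i-\gamma_i\})\mid 1\le i\le m\}$. Then $\Delta$ is a weak projecting zero decomposition of $\mathcal{A}$ for $\boldsymbol{\alpha}$, i.e. every system in $\Delta$ consists of polynomials in $\mathbb{F}_q[x_1,\dots,x_{k-1}]$, $\mathrm{proj}_k\mathrm{zero}_q(P/Q)\subseteq\bigcup_{(P',Q')\in\Delta}\mathrm{zero}_q(P'/Q')$, and $\boldsymbol{\alpha}\notin\mathrm{zero}_q(P'/Q')$ for every $(P',Q')\in\Delta$.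
   Context: For finite $P,Q\subset\mathbb{F}_q[x_1,\dots,x_k]$, $\mathrm{zero}_q(P/Q)=\{\boldsymbol{\xi}\in\mathbb{F}_q^k\mid p(\boldsymbol{\xi})=0\ \forall p\in P,\ q(\boldsymbol{\xi})\neq 0\ \forall q\in Q\}$, and $\mathrm{proj}_k\mathrm{zero}_q(P/Q)=\{\boldsymbol{\alpha}\in\mathbb{F}_q^{k-1}\mid\exists\beta\in\mathbb{F}_q:(\boldsymbol{\alpha},\beta)\in\mathrm{zero}_q(P/Q)\}$; for systems with polynomials in $\mathbb{F}_q[x_1,\dots,x_{k-1}]$, $\mathrm{zero}_q$ is the analogous subset of $\mathbb{F}_q^{k-1}$. *)

theory Defs
  imports Complex_Main "HOL-Library.Poly_Mapping"
begin

text \<open>Multivariate polynomials are elements of the monoid algebra over the exponent vectors;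
  the variables \<open>x\<^sub>1, x\<^sub>2, \<dots>\<close> of the usual numbering have indices \<open>0, 1, \<dots>\<close> here, so that
  \<open>x\<^sub>i\<close> is evaluated at position \<open>i - 1\<close> of a list.\<close>

type_synonym 'a mpoly = "(nat \<Rightarrow>\<^sub>0 nat) \<Rightarrow>\<^sub>0 'a"

definition Const :: "'a::zero \<Rightarrow> 'a mpoly" where
  "Const c = Poly_Mapping.single 0 c"

definition Var :: "nat \<Rightarrow> 'a::zero_neq_one mpoly" where
  "Var i = Poly_Mapping.single (Poly_Mapping.single i 1) 1"

definition polys :: "nat \<Rightarrow> 'a::zero mpoly set" where
  "polys k = {p. \<forall>e\<in>Poly_Mapping.keys p. Poly_Mapping.keys e \<subseteq> {..<k}}"

definition eval_mpoly :: "'a::comm_semiring_1 list \<Rightarrow> 'a mpoly \<Rightarrow> 'a" where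
  "eval_mpoly xs p =
     (\<Sum>e\<in>Poly_Mapping.keys p. Poly_Mapping.lookup p e *
        (\<Prod>i\<in>Poly_Mapping.keys e. (xs ! i) ^ Poly_Mapping.lookup e i))"

text \<open>A system \<open>(P, Q)\<close> stands for the equations \<open>p = 0\<close> and the inequations \<open>q \<noteq> 0\<close>.\<close>

type_synonym 'a poly_system = "'a mpoly set \<times> 'a mpoly set"

definition systems :: "nat \<Rightarrow> 'a::zero poly_system set" where
  "systems k = {(P, Q). finite P \<and> finite Q \<and> P \<subseteq> polys k \<and> Q \<subseteq> polys k}"

definition zeros :: "nat \<Rightarrow> 'a::comm_semiring_1 poly_system \<Rightarrow> 'a list set" where
  "zeros k A = {xs. length xs = k \<and> (\<forall>p\<in>fst A. eval_mpoly xs p = 0) \<and>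
     (\<forall>q\<in>snd A. eval_mpoly xs q \<noteq> 0)}"

definition proj_zeros :: "nat \<Rightarrow> 'a::comm_semiring_1 poly_system \<Rightarrow> 'a list set" where
  "proj_zeros k A = {\<alpha>. length \<alpha> = k - 1 \<and> (\<exists>\<beta>. \<alpha> @ [\<beta>] \<in> zeros k A)}"

definition weak_projecting_zero_decomposition ::
  "nat \<Rightarrow> 'a::comm_semiring_1 poly_system \<Rightarrow> 'a list \<Rightarrow> 'a poly_system set \<Rightarrow> bool" where
  "weak_projecting_zero_decomposition k A \<alpha> \<Delta> \<longleftrightarrow>
     \<Delta> \<subseteq> systems (k - 1) \<and>
     proj_zeros k A \<subseteq> (\<Union>B\<in>\<Delta>. zeros (k - 1) B) \<and>
     (\<forall>B\<in>\<Delta>. \<alpha> \<notin> zeros (k - 1) B)"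

text \<open>\<open>a = c\<^sub>1 x\<^sub>k^d\<^sub>1 + \<dots> + c\<^sub>m x\<^sub>k^d\<^sub>m\<close>. Neither \<open>m > 0\<close> nor \<open>c\<^sub>i \<noteq> 0\<close> is required.\<close>

definition coeff_representation ::
  "nat \<Rightarrow> 'a::comm_ring_1 mpoly \<Rightarrow> nat \<Rightarrow> (nat \<Rightarrow> 'a mpoly) \<Rightarrow> (nat \<Rightarrow> nat) \<Rightarrow> bool" where
  "coeff_representation k a m c d \<longleftrightarrow>
     inj_on d {1..m} \<and> (\<forall>i\<in>{1..m}. c i \<in> polys (k - 1)) \<and>
     a = (\<Sum>i=1..m. c i * Var (k - 1) ^ d i)"

definition proj_coeff ::
  "'a::comm_ring_1 list \<Rightarrow> nat \<Rightarrow> (nat \<Rightarrow> 'a mpoly) \<Rightarrow> 'a poly_system set" where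
  "proj_coeff \<alpha> m c = {({}, {c i - Const (eval_mpoly \<alpha> (c i))}) |i. i \<in> {1..m}}"

end

theory Submission
  imports Defs
begin

text \<open>If every coefficient takes the same value at \<open>\<alpha>'\<close> as at \<open>\<alpha>\<close>, then \<open>a\<close> restricts to
  the same univariate polynomial in the last variable over both points, so \<open>\<alpha>'\<close> has no extension
  to a zero either. Hence a point of the projection differs from \<open>\<alpha>\<close> in some coefficient.\<close>

definition eval_monom :: "'a::comm_semiring_1 list \<Rightarrow> (nat \<Rightarrow>\<^sub>0 nat) \<Rightarrow> 'a" where
  "eval_monom xs e = (\<Prod>i\<in>Poly_Mapping.keys e. (xs ! i) ^ Poly_Mapping.lookup e i)"

text \<open>A variable outside the keys has exponent 0 and contributes the factor 1. Products for
  different monomials can thus be taken over one common index set.\<close>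

lemma eval_monom_superset:
  assumes "finite S" "Poly_Mapping.keys e \<subseteq> S"
  shows "eval_monom xs e = (\<Prod>i\<in>S. (xs ! i) ^ Poly_Mapping.lookup e i)"
  unfolding eval_monom_def using assms
  by (intro prod.mono_neutral_left) (auto simp: in_keys_iff)

lemma eval_monom_0 [simp]: "eval_monom xs 0 = 1"
  by (simp add: eval_monom_def)

lemma eval_monom_add: "eval_monom xs (e + f) = eval_monom xs e * eval_monom xs f"
proof -
  let ?S = "Poly_Mapping.keys e \<union> Poly_Mapping.keys f"
  have "eval_monom xs (e + f) = (\<Prod>i\<in>?S. (xs ! i) ^ Poly_Mapping.lookup (e + f) i)"
    using Poly_Mapping.keys_add[of e f] by (intro eval_monom_superset) auto
  also have "\<dots> = (\<Prod>i\<in>?S. (xs ! i) ^ Poly_Mapping.lookup e i) *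
      (\<Prod>i\<in>?S. (xs ! i) ^ Poly_Mapping.lookup f i)"
    by (simp add: lookup_add power_add prod.distrib)
  also have "\<dots> = eval_monom xs e * eval_monom xs f"
    by (simp add: eval_monom_superset[of ?S])
  finally show ?thesis .
qed

text \<open>Exponents outside the keys carry coefficient 0. A common index set is needed for sums,
  since cancellation can make the keys of \<open>p + q\<close> smaller than the union.\<close>

lemma eval_mpoly_superset:
  assumes "finite S" "Poly_Mapping.keys p \<subseteq> S"
  shows "eval_mpoly xs p = (\<Sum>e\<in>S. Poly_Mapping.lookup p e * eval_monom xs e)"
  unfolding eval_mpoly_def eval_monom_def[symmetric] using assms
  by (intro sum.mono_neutral_left) (auto simp: in_keys_iff)

lemma eval_mpoly_0 [simp]: "eval_mpoly xs 0 = 0"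
  by (simp add: eval_mpoly_def)

lemma eval_mpoly_single: "eval_mpoly xs (Poly_Mapping.single e x) = x * eval_monom xs e"
  by (subst eval_mpoly_superset[of "{e}"]) auto

lemma eval_mpoly_Const [simp]: "eval_mpoly xs (Const x) = x"
  by (simp add: Const_def eval_mpoly_single)

lemma eval_mpoly_1 [simp]: "eval_mpoly xs 1 = 1"
  using eval_mpoly_single[of xs 0 1] by simp

lemma eval_mpoly_add: "eval_mpoly xs (p + q) = eval_mpoly xs p + eval_mpoly xs q"
proof -
  let ?S = "Poly_Mapping.keys p \<union> Poly_Mapping.keys q"
  have "eval_mpoly xs (p + q) = (\<Sum>e\<in>?S. Poly_Mapping.lookup (p + q) e * eval_monom xs e)"
    using Poly_Mapping.keys_add[of p q] by (intro eval_mpoly_superset) auto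
  also have "\<dots> = eval_mpoly xs p + eval_mpoly xs q"
    by (simp add: lookup_add distrib_right sum.distrib eval_mpoly_superset[of ?S])
  finally show ?thesis .
qed

lemma eval_mpoly_diff:
  fixes p q :: "'a::comm_ring_1 mpoly"
  shows "eval_mpoly xs (p - q) = eval_mpoly xs p - eval_mpoly xs q"
  \<comment> \<open>Additivity is applied to \<open>p = (p - q) + q\<close>.\<close>
  using eval_mpoly_add[of xs "p - q" q] by simp

lemma eval_mpoly_sum: "eval_mpoly xs (\<Sum>i\<in>I. f i) = (\<Sum>i\<in>I. eval_mpoly xs (f i))"
  by (induction I rule: infinite_finite_induct) (simp_all add: eval_mpoly_add)

text \<open>Serves to reduce multiplicativity of evaluation to products of single terms.\<close>

lemma mpoly_eq_sum_single:
  fixes p :: "'a::comm_monoid_add mpoly"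
  shows "p = (\<Sum>e\<in>Poly_Mapping.keys p. Poly_Mapping.single e (Poly_Mapping.lookup p e))"
  by (rule poly_mapping_eqI)
    (simp add: lookup_sum lookup_single when_def sum.delta' in_keys_iff cong: if_cong)

text \<open>Both factors are expanded into terms. Exponents of terms add under multiplication, and
  \<open>eval_monom\<close> turns that addition into a product, so the double sum factors
  again.\<close>

lemma eval_mpoly_mult: "eval_mpoly xs (p * q) = eval_mpoly xs p * eval_mpoly xs q"
proof -
  let ?l = Poly_Mapping.lookup and ?s = Poly_Mapping.single
  have "p * q = (\<Sum>e\<in>Poly_Mapping.keys p. ?s e (?l p e)) *
      (\<Sum>f\<in>Poly_Mapping.keys q. ?s f (?l q f))"
    using mpoly_eq_sum_single[of p] mpoly_eq_sum_single[of q] by simp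
  also have "\<dots> = (\<Sum>e\<in>Poly_Mapping.keys p. \<Sum>f\<in>Poly_Mapping.keys q.
      ?s (e + f) (?l p e * ?l q f))"
    by (simp add: sum_product mult_single)
  finally have "eval_mpoly xs (p * q) = (\<Sum>e\<in>Poly_Mapping.keys p. \<Sum>f\<in>Poly_Mapping.keys q.
      (?l p e * eval_monom xs e) * (?l q f * eval_monom xs f))"
    by (simp add: eval_mpoly_sum eval_mpoly_single eval_monom_add mult_ac)
  also have "\<dots> = eval_mpoly xs p * eval_mpoly xs q"
    by (simp add: sum_product eval_mpoly_def eval_monom_def)
  finally show ?thesis .
qed

lemma eval_mpoly_power: "eval_mpoly xs (p ^ n) = eval_mpoly xs p ^ n"
  by (induction n) (simp_all add: eval_mpoly_mult)

lemma eval_mpoly_Var [simp]: "eval_mpoly xs (Var i) = xs ! i"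
  by (simp add: Var_def eval_mpoly_single eval_monom_def)

text \<open>Only positions below \<open>length xs\<close> are read, and appending leaves these
  unchanged. This lets the coefficients ignore the last coordinate.\<close>

lemma eval_mpoly_append:
  assumes "p \<in> polys (length xs)"
  shows "eval_mpoly (xs @ ys) p = eval_mpoly xs p"
  unfolding eval_mpoly_def
proof (rule sum.cong)
  fix e assume "e \<in> Poly_Mapping.keys p"
  with assms have "Poly_Mapping.keys e \<subseteq> {..<length xs}"
    by (auto simp: polys_def)
  then show "Poly_Mapping.lookup p e * (\<Prod>i\<in>Poly_Mapping.keys e. ((xs @ ys) ! i) ^ Poly_Mapping.lookup e i) =
      Poly_Mapping.lookup p e * (\<Prod>i\<in>Poly_Mapping.keys e. (xs ! i) ^ Poly_Mapping.lookup e i)"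
    by (intro arg_cong2[where f = "(*)"] prod.cong) (auto simp: nth_append)
qed simp

lemma Const_in_polys: "Const x \<in> polys k"
  by (auto simp: polys_def Const_def)

lemma diff_in_polys:
  fixes p q :: "'a::comm_ring_1 mpoly"
  assumes "p \<in> polys k" "q \<in> polys k"
  shows "p - q \<in> polys k"
  using assms Poly_Mapping.keys_diff[of p q] unfolding polys_def by blast

text \<open>Evaluation respects sums, products and powers, so over a fixed \<open>xs\<close> the
  polynomial \<open>a\<close> becomes univariate in \<beta> and depends on \<open>xs\<close> only
  through the values of the \<open>c i\<close>.\<close>

lemma eval_coeff_representation:
  assumes "coeff_representation k a m c d" "length xs = k - 1"
  shows "eval_mpoly (xs @ [\<beta>]) a = (\<Sum>i=1..m. eval_mpoly xs (c i) * \<beta> ^ d i)"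
proof -
  have "eval_mpoly (xs @ [\<beta>]) (c i) = eval_mpoly xs (c i)" if "i \<in> {1..m}" for i
    using assms that by (intro eval_mpoly_append) (auto simp: coeff_representation_def)
  \<comment> \<open>Indices start at 0, so \<open>Var (k - 1)\<close> is the last variable and reads
    the entry just after \<open>xs\<close>.\<close>
  moreover have "(xs @ [\<beta>]) ! (k - 1) = \<beta>"
    using nth_append_length[of xs \<beta> "[]"] assms(2) by simp
  ultimately show ?thesis
    using assms(1)
    by (simp add: coeff_representation_def eval_mpoly_sum eval_mpoly_mult eval_mpoly_power)
qed

theorem theorem3:
  fixes a :: "'a::{field,finite} mpoly"
    and A :: "'a poly_system"
    and \<alpha> :: "'a list"
    and c :: "nat \<Rightarrow> 'a mpoly"
    and d :: "nat \<Rightarrow> nat"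
    and k m :: nat
  assumes "k \<ge> 1"
    and "a \<in> polys k"
    and "A = ({a}, {}) \<or> A = ({}, {a})"
    and "length \<alpha> = k - 1"
    and "\<nexists>\<beta>. \<alpha> @ [\<beta>] \<in> zeros k A"
    and "coeff_representation k a m c d"
  shows "weak_projecting_zero_decomposition k A \<alpha> (proj_coeff \<alpha> m c)"
  unfolding weak_projecting_zero_decomposition_def
proof (intro conjI)
  show "proj_coeff \<alpha> m c \<subseteq> systems (k - 1)"
    using assms(6)
    by (auto simp: proj_coeff_def systems_def coeff_representation_def
        intro!: diff_in_polys Const_in_polys)
  \<comment> \<open>At \<alpha> each difference evaluates to 0, which violates its
    inequation.\<close>
  show "\<forall>B\<in>proj_coeff \<alpha> m c. \<alpha> \<notin> zeros (k - 1) B"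
    by (auto simp: proj_coeff_def zeros_def eval_mpoly_diff)
  show "proj_zeros k A \<subseteq> (\<Union>B\<in>proj_coeff \<alpha> m c. zeros (k - 1) B)"
  proof
    fix xs assume "xs \<in> proj_zeros k A"
    then obtain \<beta> where len: "length xs = k - 1" and zero: "xs @ [\<beta>] \<in> zeros k A"
      by (auto simp: proj_zeros_def)
    have "\<exists>i\<in>{1..m}. eval_mpoly xs (c i) \<noteq> eval_mpoly \<alpha> (c i)"
    proof (rule ccontr)
      assume "\<not> ?thesis"
      \<comment> \<open>This also covers \<open>m = 0\<close>, where both sums are empty.\<close>
      then have "eval_mpoly (xs @ [\<beta>]) a = eval_mpoly (\<alpha> @ [\<beta>]) a"
        using assms(4,6) len by (simp add: eval_coeff_representation)
      \<comment> \<open>In either form of \<open>A\<close>, membership depends only on the length of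
        the point and the value of \<open>a\<close> there, so the same \<beta> extends
        \<alpha>.\<close>
      then have "\<alpha> @ [\<beta>] \<in> zeros k A"
        using zero assms(3,4) len by (auto simp: zeros_def)
      with assms(5) show False
        by blast
    qed
    then obtain i where i: "i \<in> {1..m}" "eval_mpoly xs (c i) \<noteq> eval_mpoly \<alpha> (c i)"
      by blast
    define B where "B = ({} :: 'a mpoly set, {c i - Const (eval_mpoly \<alpha> (c i))})"
    have "B \<in> proj_coeff \<alpha> m c"
      using i(1) unfolding B_def proj_coeff_def by blast
    moreover have "xs \<in> zeros (k - 1) B"
      using i(2) len by (simp add: B_def zeros_def eval_mpoly_diff)
    ultimately show "xs \<in> (\<Union>B\<in>proj_coeff \<alpha> m c. zeros (k - 1) B)"
      by blast
  qed
qed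

end
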